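(* (1) Let $H$ be a universal graph. Then $X_H(\bullet)$ is a complete invariant for finite simple graphs: for finite simple graphs $G_1,G_2$, we have $X_H(G_1)=X_H(G_2)$ if and only if $G_1\cong G_2$. (2) Let $N\subset\mathbb{N}$ and let $\{H_n\}_{n\in N}$ be a universal graph series. Then $\{X_{H_n}(\bullet)\}_{n\in N}$ is a complete invariant for finite simple graphs: for finite simple graphs $G_1,G_2$, we have $X_{H_n}(G_1)=X_{H_n}(G_2)$ for all $n\in N$ if and only if $G_1\cong G_2$.
   Context: All graphs are undirected and simple. For graphs $G,H$, a homomorphism is a map $f:V(G)\to V(H)$ with $\{f(x),f(y)\}\in E(H)$ for all $\{x,y\}\in E(G)$; $\mathrm{Hom}(G,H)$ is the set of homomorphisms. For a graph $H$ (possibly infinite) and indeterminates $x_u$ ($u\in V(H)$), the $H$-chromatic function of a finite graph $G$ is the formal power series $X_H(G)=\sum_{\varphi\in\mathrm{Hom}(G,H)}\prod_{v\in V(G)}x_{\varphi(v)}$. An infinite graph $H$ is universal if it contains every finite graph as an induced subgraph. A family $\{H_n\}_{n\in N}$ ($N\subset\mathbb{N}$) of graphs is a universal graph series if for every finite simple graph $G$ there exists $n\in N$ such that $G$ is an induced subgraph of $H_n$. *)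

theory Defs
  imports "HOL-Library.FuncSet" "HOL-Library.Poly_Mapping"
begin

record 'a sgraph =
  verts :: "'a set"
  edges :: "'a set set"

definition simple_graph :: "'a sgraph \<Rightarrow> bool" where
  "simple_graph G \<longleftrightarrow> edges G \<subseteq> {e. e \<subseteq> verts G \<and> card e = 2}"

definition finite_simple_graph :: "'a sgraph \<Rightarrow> bool" where
  "finite_simple_graph G \<longleftrightarrow> simple_graph G \<and> finite (verts G)"

definition graph_iso :: "'a sgraph \<Rightarrow> 'b sgraph \<Rightarrow> bool" (infix "\<simeq>\<^sub>g" 50) where
  "G \<simeq>\<^sub>g H \<longleftrightarrow> (\<exists>f. bij_betw f (verts G) (verts H) \<and>
     (\<forall>x\<in>verts G. \<forall>y\<in>verts G. {x, y} \<in> edges G \<longleftrightarrow> {f x, f y} \<in> edges H))"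

definition induced_subgraph :: "'a sgraph \<Rightarrow> 'a set \<Rightarrow> 'a sgraph" where
  "induced_subgraph H S = \<lparr>verts = S, edges = {e \<in> edges H. e \<subseteq> S}\<rparr>"

definition contains_induced :: "'b sgraph \<Rightarrow> 'a sgraph \<Rightarrow> bool" where
  "contains_induced H G \<longleftrightarrow> (\<exists>S\<subseteq>verts H. G \<simeq>\<^sub>g induced_subgraph H S)"

text \<open>Homomorphisms are maps on \<^term>\<open>verts G\<close>; they are represented by functions that are
  \<^const>\<open>undefined\<close> elsewhere, so that each one is counted once.\<close>

definition graph_homs :: "'a sgraph \<Rightarrow> 'b sgraph \<Rightarrow> ('a \<Rightarrow> 'b) set" where
  "graph_homs G H = {f \<in> verts G \<rightarrow>\<^sub>E verts H.
     \<forall>x y. {x, y} \<in> edges G \<longrightarrow> {f x, f y} \<in> edges H}"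

text \<open>Finite graphs on natural numbers represent all finite graphs up to isomorphism; the lemmas
  \<open>universal_graph_any\<close> and \<open>universal_graph_series_any\<close> below give the
  properties for finite graphs over arbitrary vertex types.\<close>

definition universal_graph :: "'v sgraph \<Rightarrow> bool" where
  "universal_graph H \<longleftrightarrow> simple_graph H \<and> infinite (verts H) \<and>
     (\<forall>G :: nat sgraph. finite_simple_graph G \<longrightarrow> contains_induced H G)"

definition universal_graph_series :: "nat set \<Rightarrow> (nat \<Rightarrow> 'v sgraph) \<Rightarrow> bool" where
  "universal_graph_series N H \<longleftrightarrow> (\<forall>n\<in>N. simple_graph (H n)) \<and>
     (\<forall>G :: nat sgraph. finite_simple_graph G \<longrightarrow> (\<exists>n\<in>N. contains_induced (H n) G))"

text \<open>A monomial in the indeterminates \<open>x\<^sub>u\<close> is its finitely supported exponent vector,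
  a polynomial is a finitely supported coefficient function on monomials, and a
  formal power series is an arbitrary one.\<close>

type_synonym 'v monomial = "'v \<Rightarrow>\<^sub>0 nat"
type_synonym 'v polynomial = "'v monomial \<Rightarrow>\<^sub>0 int"
type_synonym 'v power_series = "'v monomial \<Rightarrow> int"

definition indet :: "'v \<Rightarrow> 'v polynomial" where
  "indet u = Poly_Mapping.single (Poly_Mapping.single u 1) 1"

definition hom_term :: "'a sgraph \<Rightarrow> ('a \<Rightarrow> 'v) \<Rightarrow> 'v polynomial" where
  "hom_term G \<phi> = (\<Prod>v\<in>verts G. indet (\<phi> v))"

text \<open>The sum over all homomorphisms may be infinite. It is taken coefficientwise, over the
  homomorphisms that contribute to the given coefficient; there are only finitely many of them
  when \<open>G\<close> is finite (lemma \<open>finite_contributing_homs\<close>).\<close>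

definition chromatic_function :: "'v sgraph \<Rightarrow> 'a sgraph \<Rightarrow> 'v power_series" where
  "chromatic_function H G = (\<lambda>m.
     \<Sum>\<phi> | \<phi> \<in> graph_homs G H \<and> Poly_Mapping.lookup (hom_term G \<phi>) m \<noteq> 0.
       Poly_Mapping.lookup (hom_term G \<phi>) m)"

lemma hom_term_eq_single:
  "hom_term G \<phi> = Poly_Mapping.single (\<Sum>v\<in>verts G. Poly_Mapping.single (\<phi> v) 1) 1"
proof -
  have "(\<Prod>v\<in>A. indet (\<phi> v)) = Poly_Mapping.single (\<Sum>v\<in>A. Poly_Mapping.single (\<phi> v) 1) 1" for A
    by (induction A rule: infinite_finite_induct)
       (simp_all add: indet_def mult_single)
  then show ?thesis by (simp add: hom_term_def)
qed

lemma finite_contributing_homs: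
  assumes "finite_simple_graph G"
  shows "finite {\<phi> \<in> graph_homs G H. Poly_Mapping.lookup (hom_term G \<phi>) m \<noteq> 0}"
proof (rule finite_subset)
  have fin: "finite (verts G)" using assms by (simp add: finite_simple_graph_def)
  show "finite (verts G \<rightarrow>\<^sub>E Poly_Mapping.keys m)" using fin by (simp add: finite_PiE)
  show "{\<phi> \<in> graph_homs G H. Poly_Mapping.lookup (hom_term G \<phi>) m \<noteq> 0} \<subseteq> verts G \<rightarrow>\<^sub>E Poly_Mapping.keys m"
  proof
    fix \<phi> assume "\<phi> \<in> {\<phi> \<in> graph_homs G H. Poly_Mapping.lookup (hom_term G \<phi>) m \<noteq> 0}"
    then have hom: "\<phi> \<in> graph_homs G H" and nz: "Poly_Mapping.lookup (hom_term G \<phi>) m \<noteq> 0" by auto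
    have m: "m = (\<Sum>v\<in>verts G. Poly_Mapping.single (\<phi> v) 1)"
      using nz by (auto simp: hom_term_eq_single lookup_single when_def split: if_splits)
    have "\<phi> v \<in> Poly_Mapping.keys m" if v: "v \<in> verts G" for v
    proof -
      have "Poly_Mapping.lookup m (\<phi> v) = (\<Sum>w\<in>verts G. Poly_Mapping.lookup (Poly_Mapping.single (\<phi> w) 1) (\<phi> v))"
        by (simp add: m lookup_sum)
      also have "\<dots> \<ge> Poly_Mapping.lookup (Poly_Mapping.single (\<phi> v) 1) (\<phi> v)"
        using fin v by (intro member_le_sum) auto
      finally show ?thesis by (simp add: in_keys_iff)
    qed
    then show "\<phi> \<in> verts G \<rightarrow>\<^sub>E Poly_Mapping.keys m"
      using hom by (auto simp: graph_homs_def PiE_def)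
  qed
qed

lemma graph_iso_trans:
  assumes "F \<simeq>\<^sub>g G" "G \<simeq>\<^sub>g H" shows "F \<simeq>\<^sub>g H"
proof -
  from assms(1) obtain f where f: "bij_betw f (verts F) (verts G)"
    "\<And>x y. x \<in> verts F \<Longrightarrow> y \<in> verts F \<Longrightarrow> {x, y} \<in> edges F \<longleftrightarrow> {f x, f y} \<in> edges G"
    unfolding graph_iso_def by blast
  from assms(2) obtain g where g: "bij_betw g (verts G) (verts H)"
    "\<And>x y. x \<in> verts G \<Longrightarrow> y \<in> verts G \<Longrightarrow> {x, y} \<in> edges G \<longleftrightarrow> {g x, g y} \<in> edges H"
    unfolding graph_iso_def by blast
  have "bij_betw (g \<circ> f) (verts F) (verts H)" using f(1) g(1) by (rule bij_betw_trans)
  moreover have "{x, y} \<in> edges F \<longleftrightarrow> {(g \<circ> f) x, (g \<circ> f) y} \<in> edges H"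
    if "x \<in> verts F" "y \<in> verts F" for x y
    using f(2)[OF that] g(2)[of "f x" "f y"] bij_betwE[OF f(1)] that by simp
  ultimately show ?thesis unfolding graph_iso_def by blast
qed

lemma finite_graph_iso_nat:
  assumes "finite_simple_graph G"
  obtains G' :: "nat sgraph" where "finite_simple_graph G'" "G \<simeq>\<^sub>g G'"
proof -
  have fin: "finite (verts G)" and sim: "edges G \<subseteq> {e. e \<subseteq> verts G \<and> card e = 2}"
    using assms by (auto simp: finite_simple_graph_def simple_graph_def)
  obtain f :: "_ \<Rightarrow> nat" where inj: "inj_on f (verts G)"
    using finite_imp_inj_to_nat_seg[OF fin] by blast
  define G' where "G' = \<lparr>verts = f ` verts G, edges = (`) f ` edges G\<rparr>"
  have "card (f ` e) = 2" if "e \<in> edges G" for e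
  proof -
    have "e \<subseteq> verts G" "card e = 2" using that sim by auto
    then show ?thesis using card_image[OF inj_on_subset[OF inj]] by simp
  qed
  then have "finite_simple_graph G'"
    using fin sim by (auto simp: finite_simple_graph_def simple_graph_def G'_def)
  moreover have "{x, y} \<in> edges G \<longleftrightarrow> {f x, f y} \<in> edges G'"
    if "x \<in> verts G" "y \<in> verts G" for x y
  proof
    assume "{x, y} \<in> edges G"
    then have "f ` {x, y} \<in> (`) f ` edges G" by (rule imageI)
    then show "{f x, f y} \<in> edges G'" by (simp add: G'_def)
  next
    assume "{f x, f y} \<in> edges G'"
    then obtain e where e: "e \<in> edges G" "f ` {x, y} = f ` e" by (auto simp: G'_def)
    moreover have "e \<subseteq> verts G" using e sim by auto
    ultimately have "{x, y} = e" using inj_on_image_eq_iff[OF inj, of "{x, y}" e] that by simp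
    then show "{x, y} \<in> edges G" using e by simp
  qed
  ultimately have "finite_simple_graph G'" "G \<simeq>\<^sub>g G'"
    using inj unfolding graph_iso_def by (auto simp: G'_def bij_betw_def intro!: exI[of _ f])
  then show thesis by (rule that)
qed

lemma universal_graph_any:
  assumes "universal_graph H" "finite_simple_graph G" shows "contains_induced H G"
  using finite_graph_iso_nat[OF assms(2)] assms(1) graph_iso_trans
  unfolding universal_graph_def contains_induced_def by metis

lemma universal_graph_series_any:
  assumes "universal_graph_series N H" "finite_simple_graph G"
  shows "\<exists>n\<in>N. contains_induced (H n) G"
  using finite_graph_iso_nat[OF assms(2)] assms(1) graph_iso_trans
  unfolding universal_graph_series_def contains_induced_def by metis

end

theory Submission
  imports Defs
begin

text \<open>Embed \<open>G\<^sub>1\<close> into some \<open>H\<^sub>n\<close> with vertex set \<open>S\<close>. The squarefree monomial \<open>\<Prod>\<^bsub>u \<in> S\<^esub> x\<^sub>u\<close> occurs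
  in the \<open>H\<^sub>n\<close>-chromatic function of \<open>G\<^sub>1\<close>, hence in that of \<open>G\<^sub>2\<close>, and a homomorphism from \<open>G\<^sub>2\<close> to
  \<open>H\<^sub>n\<close> with this monomial is a bijective homomorphism from \<open>G\<^sub>2\<close> to \<open>G\<^sub>1\<close>. By symmetry there is one
  from \<open>G\<^sub>1\<close> to \<open>G\<^sub>2\<close> as well, so both graphs have the same number of edges and either map is an
  isomorphism. A universal graph is a universal graph series with one member.\<close>

section \<open>Bijective homomorphisms versus isomorphisms\<close>

text \<open>Weaker than an isomorphism, since non-edges may be sent to edges. A single comparison of
  coefficients yields only this much.\<close>

definition bij_hom :: "('a \<Rightarrow> 'b) \<Rightarrow> 'a sgraph \<Rightarrow> 'b sgraph \<Rightarrow> bool" where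
  "bij_hom f G H \<longleftrightarrow> bij_betw f (verts G) (verts H) \<and>
     (\<forall>x y. {x, y} \<in> edges G \<longrightarrow> {f x, f y} \<in> edges H)"

lemma simple_graph_edge_verts:
  assumes "simple_graph G" "{x, y} \<in> edges G"
  shows "x \<in> verts G" "y \<in> verts G"
  using assms by (auto simp: simple_graph_def)

text \<open>The inverse of an isomorphism is made explicit because reindexing a sum over
  homomorphisms takes a map in each direction.\<close>

lemma graph_iso_bij_homs:
  assumes "simple_graph G" "simple_graph H" "G \<simeq>\<^sub>g H"
  obtains f g where "bij_hom f G H" "bij_hom g H G"
    "\<And>x. x \<in> verts G \<Longrightarrow> g (f x) = x" "\<And>y. y \<in> verts H \<Longrightarrow> f (g y) = y"
proof -
  from assms(3) obtain f where f: "bij_betw f (verts G) (verts H)"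
    and e: "\<And>x y. x \<in> verts G \<Longrightarrow> y \<in> verts G \<Longrightarrow> {x, y} \<in> edges G \<longleftrightarrow> {f x, f y} \<in> edges H"
    unfolding graph_iso_def by blast
  define g where "g = the_inv_into (verts G) f"
  have gf: "g (f x) = x" if "x \<in> verts G" for x
    using f that by (simp add: g_def bij_betw_def the_inv_into_f_f)
  have fg: "f (g y) = y" if "y \<in> verts H" for y
    using f that by (simp add: g_def f_the_inv_into_f_bij_betw)
  have g: "bij_betw g (verts H) (verts G)"
    using f unfolding g_def by (rule bij_betw_the_inv_into)
  have "bij_hom f G H"
    using f e simple_graph_edge_verts[OF assms(1)] unfolding bij_hom_def by blast
  moreover have "{g x, g y} \<in> edges G" if xy: "{x, y} \<in> edges H" for x y
  proof -
    have "x \<in> verts H" "y \<in> verts H" using simple_graph_edge_verts[OF assms(2) xy] .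
    then show ?thesis using e[of "g x" "g y"] fg xy bij_betwE[OF g] by simp
  qed
  then have "bij_hom g H G" using g unfolding bij_hom_def by blast
  ultimately show thesis using gf fg that by blast
qed

lemma finite_edges:
  assumes "finite_simple_graph G"
  shows "finite (edges G)"
  using assms
  by (auto simp: finite_simple_graph_def simple_graph_def intro: finite_subset[of _ "Pow (verts G)"])

lemma bij_hom_edges:
  assumes "simple_graph G" "bij_hom f G H"
  shows "(`) f ` edges G \<subseteq> edges H" "inj_on ((`) f) (edges G)"
proof -
  show "(`) f ` edges G \<subseteq> edges H"
  proof safe
    fix e assume e: "e \<in> edges G"
    then have "card e = 2" using assms(1) by (auto simp: simple_graph_def)
    then obtain x y where "e = {x, y}" by (auto simp: card_2_iff)
    then show "f ` e \<in> edges H" using e assms(2) by (simp add: bij_hom_def)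
  qed
  have "inj_on f (verts G)" using assms(2) by (simp add: bij_hom_def bij_betw_def)
  then have "inj_on ((`) f) (Pow (verts G))" by (rule inj_on_image_Pow)
  then show "inj_on ((`) f) (edges G)"
    by (rule inj_on_subset) (use assms(1) in \<open>auto simp: simple_graph_def\<close>)
qed

lemma bij_hom_card_edges_le:
  assumes "simple_graph G" "finite_simple_graph H" "bij_hom f G H"
  shows "card (edges G) \<le> card (edges H)"
  using bij_hom_edges[OF assms(1,3)] finite_edges[OF assms(2)]
  by (intro card_inj_on_le)

text \<open>The maps \<open>f\<close> and \<open>g\<close> need not be mutually inverse. Together
  they force equal finite numbers of edges, so the injection of edges induced by \<open>f\<close> is
  onto, and thus \<open>f\<close> also reflects edges.\<close>

lemma graph_iso_if_bij_homs:
  assumes G: "finite_simple_graph G" and H: "finite_simple_graph H"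
    and f: "bij_hom f G H" and g: "bij_hom g H G"
  shows "G \<simeq>\<^sub>g H"
proof -
  have sG: "simple_graph G" and sH: "simple_graph H"
    using G H by (auto simp: finite_simple_graph_def)
  have bij: "bij_betw f (verts G) (verts H)" using f by (simp add: bij_hom_def)
  then have inj: "inj_on f (verts G)" by (simp add: bij_betw_def)
  have "card (edges G) = card (edges H)"
    using bij_hom_card_edges_le[OF sG H f] bij_hom_card_edges_le[OF sH G g] by simp
  then have img: "(`) f ` edges G = edges H"
    using bij_hom_edges[OF sG f] finite_edges[OF H] by (simp add: card_image card_subset_eq)
  have "{x, y} \<in> edges G" if xy: "x \<in> verts G" "y \<in> verts G" "{f x, f y} \<in> edges H" for x y
  proof -
    \<comment> \<open>Surjectivity on edges gives only some edge \<open>e\<close> with the same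
      image as \<open>{x, y}\<close>; injectivity of \<open>f\<close> on vertices identifies the
      two.\<close>
    obtain e where e: "e \<in> edges G" "f ` {x, y} = f ` e" using xy(3) img by auto
    have "e \<subseteq> verts G" using e(1) sG by (auto simp: simple_graph_def)
    then have "{x, y} = e" using inj_on_image_eq_iff[OF inj, of "{x, y}" e] e(2) xy by simp
    then show ?thesis using e(1) by simp
  qed
  then show ?thesis using bij f unfolding graph_iso_def bij_hom_def by blast
qed

section \<open>Invariance of the chromatic function under isomorphism\<close>

text \<open>Composing with \<open>f\<close> only permutes the factors of a commutative product. The
  \<open>restrict\<close> gives the composite the value \<open>undefined\<close> off the vertices,
  as \<open>graph_homs\<close> requires.\<close>

lemma hom_term_cong_bij:
  assumes "bij_betw f (verts G\<^sub>1) (verts G\<^sub>2)"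
  shows "hom_term G\<^sub>1 (restrict (\<phi> \<circ> f) (verts G\<^sub>1)) = hom_term G\<^sub>2 \<phi>"
  using sum.reindex_bij_betw[OF assms, of "\<lambda>v. Poly_Mapping.single (\<phi> v) (1::nat)"]
  by (simp add: hom_term_eq_single)

lemma graph_homs_comp_bij_hom:
  assumes "simple_graph G\<^sub>1" "bij_hom f G\<^sub>1 G\<^sub>2" "\<phi> \<in> graph_homs G\<^sub>2 H"
  shows "restrict (\<phi> \<circ> f) (verts G\<^sub>1) \<in> graph_homs G\<^sub>1 H"
proof -
  have "f v \<in> verts G\<^sub>2" if "v \<in> verts G\<^sub>1" for v
    using assms(2) that by (auto simp: bij_hom_def dest: bij_betwE)
  then have "restrict (\<phi> \<circ> f) (verts G\<^sub>1) \<in> verts G\<^sub>1 \<rightarrow>\<^sub>E verts H"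
    using assms(3) by (auto simp: graph_homs_def)
  moreover have "{restrict (\<phi> \<circ> f) (verts G\<^sub>1) x, restrict (\<phi> \<circ> f) (verts G\<^sub>1) y} \<in> edges H"
    if xy: "{x, y} \<in> edges G\<^sub>1" for x y
    using simple_graph_edge_verts[OF assms(1) xy] assms(2,3) xy
    by (simp add: graph_homs_def bij_hom_def)
  ultimately show ?thesis unfolding graph_homs_def by blast
qed

lemma chromatic_function_iso:
  assumes G1: "simple_graph G\<^sub>1" and G2: "simple_graph G\<^sub>2" and iso: "G\<^sub>1 \<simeq>\<^sub>g G\<^sub>2"
  shows "chromatic_function H G\<^sub>1 = chromatic_function H G\<^sub>2"
proof -
  obtain f g where f: "bij_hom f G\<^sub>1 G\<^sub>2" and g: "bij_hom g G\<^sub>2 G\<^sub>1"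
    and gf: "\<And>x. x \<in> verts G\<^sub>1 \<Longrightarrow> g (f x) = x" and fg: "\<And>y. y \<in> verts G\<^sub>2 \<Longrightarrow> f (g y) = y"
    using graph_iso_bij_homs[OF assms] by blast
  have bf: "bij_betw f (verts G\<^sub>1) (verts G\<^sub>2)" and bg: "bij_betw g (verts G\<^sub>2) (verts G\<^sub>1)"
    using f g by (simp_all add: bij_hom_def)
  \<comment> \<open>On vertices \<open>f\<close> and \<open>g\<close> cancel; elsewhere both sides
    are \<open>undefined\<close>.\<close>
  have inv1: "restrict (restrict (\<phi> \<circ> g) (verts G\<^sub>2) \<circ> f) (verts G\<^sub>1) = \<phi>"
    if "\<phi> \<in> graph_homs G\<^sub>1 H" for \<phi>
    using that gf bij_betwE[OF bf]
    by (auto simp: graph_homs_def fun_eq_iff PiE_def extensional_def restrict_def)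
  have inv2: "restrict (restrict (\<phi> \<circ> f) (verts G\<^sub>1) \<circ> g) (verts G\<^sub>2) = \<phi>"
    if "\<phi> \<in> graph_homs G\<^sub>2 H" for \<phi>
    using that fg bij_betwE[OF bg]
    by (auto simp: graph_homs_def fun_eq_iff PiE_def extensional_def restrict_def)
  show ?thesis
    unfolding chromatic_function_def
  proof (intro ext sum.reindex_bij_witness[where i = "\<lambda>\<phi>. restrict (\<phi> \<circ> f) (verts G\<^sub>1)"
        and j = "\<lambda>\<phi>. restrict (\<phi> \<circ> g) (verts G\<^sub>2)"], goal_cases)
    \<comment> \<open>The index sets contain only contributing homomorphisms; they are respected
      because composition leaves \<open>hom_term\<close> unchanged.\<close>
    case (2 m \<phi>)
    then show ?case
      using graph_homs_comp_bij_hom[OF G2 g] by (simp only: mem_Collect_eq hom_term_cong_bij[OF bg]) blast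
  next
    case (4 m \<phi>)
    then show ?case
      using graph_homs_comp_bij_hom[OF G1 f] by (simp only: mem_Collect_eq hom_term_cong_bij[OF bf]) blast
  qed (simp_all only: mem_Collect_eq inv1 inv2 hom_term_cong_bij[OF bg])
qed

section \<open>Coefficients and squarefree monomials\<close>

text \<open>Every contributing homomorphism adds exactly 1, so nothing cancels. Finiteness of the
  index set matters, as a sum over an infinite set is 0 by convention.\<close>

lemma chromatic_function_nonzero_iff:
  assumes "finite_simple_graph G"
  shows "chromatic_function H G m \<noteq> 0 \<longleftrightarrow>
    (\<exists>\<phi>\<in>graph_homs G H. (\<Sum>v\<in>verts G. Poly_Mapping.single (\<phi> v) 1) = m)"
proof -
  let ?A = "{\<phi> \<in> graph_homs G H. Poly_Mapping.lookup (hom_term G \<phi>) m \<noteq> 0}"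
  have A: "?A = {\<phi> \<in> graph_homs G H. (\<Sum>v\<in>verts G. Poly_Mapping.single (\<phi> v) 1) = m}"
    by (auto simp: hom_term_eq_single lookup_single when_def split: if_splits)
  have "chromatic_function H G m = (\<Sum>\<phi>\<in>?A. 1)"
    unfolding chromatic_function_def
    by (intro sum.cong) (auto simp: hom_term_eq_single lookup_single when_def split: if_splits)
  then show ?thesis using finite_contributing_homs[OF assms, of H m] A by auto
qed

lemma lookup_sum_single:
  assumes "finite V"
  shows "Poly_Mapping.lookup (\<Sum>v\<in>V. Poly_Mapping.single (\<phi> v) (1::nat)) u = card {v \<in> V. \<phi> v = u}"
  using assms by (simp add: lookup_sum lookup_single when_def sum.If_cases Int_def)

lemma bij_betw_if_squarefree_monomial:
  assumes V: "finite V" and W: "finite W" and f: "inj_on f W"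
    and eq: "(\<Sum>v\<in>V. Poly_Mapping.single (\<phi> v) (1::nat)) = (\<Sum>w\<in>W. Poly_Mapping.single (f w) 1)"
  shows "bij_betw \<phi> V (f ` W)"
proof -
  have card: "card {v \<in> V. \<phi> v = u} = card {w \<in> W. f w = u}" for u
    using arg_cong[OF eq, of "\<lambda>m. Poly_Mapping.lookup m u"]
    by (simp only: lookup_sum_single[OF V] lookup_sum_single[OF W])
  have "u \<in> \<phi> ` V \<longleftrightarrow> card {v \<in> V. \<phi> v = u} \<noteq> 0" for u
    using V by auto
  moreover have "u \<in> f ` W \<longleftrightarrow> card {w \<in> W. f w = u} \<noteq> 0" for u
    using W by auto
  ultimately have img: "\<phi> ` V = f ` W"
    unfolding card by (intro set_eqI) (simp only:)
  have "inj_on \<phi> V"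
  proof (rule inj_onI)
    fix x y assume xy: "x \<in> V" "y \<in> V" "\<phi> x = \<phi> y"
    have "\<phi> x \<in> f ` W" using img xy(1) by blast
    then obtain w where "w \<in> W" "f w = \<phi> x" by auto
    then have "{w \<in> W. f w = \<phi> x} = {w}" using f by (auto simp: inj_on_def)
    then have "card {v \<in> V. \<phi> v = \<phi> x} = 1" using card by simp
    then obtain z where "{v \<in> V. \<phi> v = \<phi> x} = {z}" by (rule card_1_singletonE)
    then have "x \<in> {z}" "y \<in> {z}" using xy by auto
    then show "x = y" by simp
  qed
  with img show ?thesis by (simp add: bij_betw_def)
qed

lemma bij_hom_if_chromatic_function_eq:
  assumes G1: "finite_simple_graph G\<^sub>1" and G2: "finite_simple_graph G\<^sub>2"
    and con: "contains_induced H G\<^sub>1"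
    and eq: "chromatic_function H G\<^sub>1 = chromatic_function H G\<^sub>2"
  obtains h where "bij_hom h G\<^sub>2 G\<^sub>1"
proof -
  have s1: "simple_graph G\<^sub>1" and s2: "simple_graph G\<^sub>2"
    and fin: "finite (verts G\<^sub>1)" "finite (verts G\<^sub>2)"
    using G1 G2 by (auto simp: finite_simple_graph_def)
  obtain S f where S: "S \<subseteq> verts H" and f: "bij_betw f (verts G\<^sub>1) S"
    and e: "\<And>x y. x \<in> verts G\<^sub>1 \<Longrightarrow> y \<in> verts G\<^sub>1 \<Longrightarrow> {x, y} \<in> edges G\<^sub>1 \<longleftrightarrow> {f x, f y} \<in> edges H"
  \<comment> \<open>Images under \<open>f\<close> lie in \<open>S\<close>, so the edges of the
    induced subgraph between them are just those of \<open>H\<close>.\<close>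
  proof -
    obtain S f where "S \<subseteq> verts H" "bij_betw f (verts G\<^sub>1) S"
      "\<forall>x\<in>verts G\<^sub>1. \<forall>y\<in>verts G\<^sub>1. {x, y} \<in> edges G\<^sub>1 \<longleftrightarrow> {f x, f y} \<in> edges H \<and> {f x, f y} \<subseteq> S"
      using con by (auto simp: contains_induced_def graph_iso_def induced_subgraph_def)
    then show thesis using that[of S f] by (auto dest: bij_betwE)
  qed
  have inj: "inj_on f (verts G\<^sub>1)" and img: "f ` verts G\<^sub>1 = S" using f by (auto simp: bij_betw_def)
  \<comment> \<open>As \<open>f\<close> is injective with image \<open>S\<close>, this is the
    product of the indeterminates of \<open>S\<close>, each to the first power.\<close>
  define m :: "'c \<Rightarrow>\<^sub>0 nat" where "m = (\<Sum>v\<in>verts G\<^sub>1. Poly_Mapping.single (f v) 1)"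
  have "{restrict f (verts G\<^sub>1) x, restrict f (verts G\<^sub>1) y} \<in> edges H"
    if xy: "{x, y} \<in> edges G\<^sub>1" for x y
    using simple_graph_edge_verts[OF s1 xy] e[of x y] xy by simp
  moreover have "restrict f (verts G\<^sub>1) \<in> verts G\<^sub>1 \<rightarrow>\<^sub>E verts H"
    using S img by auto
  ultimately have "restrict f (verts G\<^sub>1) \<in> graph_homs G\<^sub>1 H"
    unfolding graph_homs_def by blast
  moreover have "(\<Sum>v\<in>verts G\<^sub>1. Poly_Mapping.single (restrict f (verts G\<^sub>1) v) 1) = m"
    by (simp add: m_def)
  ultimately have "chromatic_function H G\<^sub>1 m \<noteq> 0"
    using chromatic_function_nonzero_iff[OF G1] by blast
  then have "chromatic_function H G\<^sub>2 m \<noteq> 0" by (simp add: eq)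
  then obtain \<phi> where \<phi>: "\<phi> \<in> graph_homs G\<^sub>2 H"
    and m: "(\<Sum>v\<in>verts G\<^sub>2. Poly_Mapping.single (\<phi> v) 1) = m"
    using chromatic_function_nonzero_iff[OF G2] by blast
  have b: "bij_betw \<phi> (verts G\<^sub>2) S"
    using bij_betw_if_squarefree_monomial[OF fin(2,1) inj] m img by (simp add: m_def)
  define g where "g = the_inv_into (verts G\<^sub>1) f"
  have g: "bij_betw g S (verts G\<^sub>1)" unfolding g_def using f by (rule bij_betw_the_inv_into)
  have fg: "f (g u) = u" if "u \<in> S" for u
    using f that by (simp add: g_def f_the_inv_into_f_bij_betw)
  \<comment> \<open>Here the copy must be induced: an edge of \<open>H\<close> inside
    \<open>S\<close> pulls back to an edge of \<open>G\<^sub>1\<close>.\<close>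
  have "{(g \<circ> \<phi>) x, (g \<circ> \<phi>) y} \<in> edges G\<^sub>1" if xy: "{x, y} \<in> edges G\<^sub>2" for x y
  proof -
    have "\<phi> x \<in> S" "\<phi> y \<in> S"
      using simple_graph_edge_verts[OF s2 xy] bij_betwE[OF b] by auto
    moreover have "{\<phi> x, \<phi> y} \<in> edges H" using \<phi> xy by (auto simp: graph_homs_def)
    ultimately show ?thesis
      using e[of "g (\<phi> x)" "g (\<phi> y)"] bij_betwE[OF g] fg by simp
  qed
  then have "bij_hom (g \<circ> \<phi>) G\<^sub>2 G\<^sub>1"
    using bij_betw_trans[OF b g] unfolding bij_hom_def by blast
  then show thesis by (rule that)
qed

section \<open>Complete invariance\<close>

text \<open>Universality is applied to each graph separately. The two indices may differ, which is
  harmless because the functions agree for all \<open>n\<close> in \<open>N\<close>.\<close>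

lemma universal_graph_series_complete:
  assumes H: "universal_graph_series N H"
    and G1: "finite_simple_graph G\<^sub>1" and G2: "finite_simple_graph G\<^sub>2"
  shows "(\<forall>n\<in>N. chromatic_function (H n) G\<^sub>1 = chromatic_function (H n) G\<^sub>2) \<longleftrightarrow> G\<^sub>1 \<simeq>\<^sub>g G\<^sub>2"
proof
  assume eq: "\<forall>n\<in>N. chromatic_function (H n) G\<^sub>1 = chromatic_function (H n) G\<^sub>2"
  obtain n where "n \<in> N" "contains_induced (H n) G\<^sub>1"
    using universal_graph_series_any[OF H G1] by blast
  then obtain g where g: "bij_hom g G\<^sub>2 G\<^sub>1"
    using bij_hom_if_chromatic_function_eq[OF G1 G2] eq by metis
  obtain n' where "n' \<in> N" "contains_induced (H n') G\<^sub>2"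
    using universal_graph_series_any[OF H G2] by blast
  then obtain f where f: "bij_hom f G\<^sub>1 G\<^sub>2"
    using bij_hom_if_chromatic_function_eq[OF G2 G1] eq by metis
  show "G\<^sub>1 \<simeq>\<^sub>g G\<^sub>2" using graph_iso_if_bij_homs[OF G1 G2 f g] .
next
  assume "G\<^sub>1 \<simeq>\<^sub>g G\<^sub>2"
  then show "\<forall>n\<in>N. chromatic_function (H n) G\<^sub>1 = chromatic_function (H n) G\<^sub>2"
    using G1 G2 by (simp add: finite_simple_graph_def chromatic_function_iso)
qed

lemma universal_graph_complete:
  assumes "universal_graph H" "finite_simple_graph G\<^sub>1" "finite_simple_graph G\<^sub>2"
  shows "chromatic_function H G\<^sub>1 = chromatic_function H G\<^sub>2 \<longleftrightarrow> G\<^sub>1 \<simeq>\<^sub>g G\<^sub>2"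
proof -
  have "universal_graph_series {0} (\<lambda>_. H)"
    using assms(1) by (simp add: universal_graph_def universal_graph_series_def)
  from universal_graph_series_complete[OF this assms(2,3)] show ?thesis by simp
qed

theorem theorem1p10:
  "(\<forall>H :: 'v sgraph. universal_graph H \<longrightarrow>
      (\<forall>(G\<^sub>1 :: 'a sgraph) (G\<^sub>2 :: 'b sgraph).
         finite_simple_graph G\<^sub>1 \<longrightarrow> finite_simple_graph G\<^sub>2 \<longrightarrow>
         (chromatic_function H G\<^sub>1 = chromatic_function H G\<^sub>2 \<longleftrightarrow> G\<^sub>1 \<simeq>\<^sub>g G\<^sub>2))) \<and>
   (\<forall>(N :: nat set) (H :: nat \<Rightarrow> 'w sgraph). universal_graph_series N H \<longrightarrow>
      (\<forall>(G\<^sub>1 :: 'a sgraph) (G\<^sub>2 :: 'b sgraph).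
         finite_simple_graph G\<^sub>1 \<longrightarrow> finite_simple_graph G\<^sub>2 \<longrightarrow>
         ((\<forall>n\<in>N. chromatic_function (H n) G\<^sub>1 = chromatic_function (H n) G\<^sub>2) \<longleftrightarrow>
          G\<^sub>1 \<simeq>\<^sub>g G\<^sub>2)))"
  by (intro conjI allI impI universal_graph_complete universal_graph_series_complete)

end
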